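(* Let $m\in C_{1-\xi;\Psi}(J,\mathbb{R})$. Let $t_1\in(0,T]$ be such that $m(t_1)=0$ and $m(t)\ge0$ for all $t\in(0,t_1)$. Then ${}^H\mathcal{D}^{\mu,\nu;\Psi}_{0^+}m(t_1)\le0$.
   Context: Fix $T>0$, $J=[0,T]$, $0<\mu<1$, $0\le\nu\le1$, $\xi=\mu+\nu(1-\mu)$, and an increasing function $\Psi\in C^1(J,\mathbb{R})$ with $\Psi'(t)\ne0$ for all $t\in J$. $C_{1-\xi;\Psi}(J,\mathbb{R})$ is the set of functions $h:(0,T]\to\mathbb{R}$ such that $t\mapsto(\Psi(t)-\Psi(0))^{1-\xi}h(t)$ is (extends to) a continuous function on $J$. For $\alpha>0$, $I_{0^+}^{\alpha;\Psi}h(t)=\frac{1}{\Gamma(\alpha)}\int_0^t\Psi'(s)(\Psi(t)-\Psi(s))^{\alpha-1}h(s)\,ds$, and $I_{0^+}^{0;\Psi}$ is the identity. The $\Psi$-Hilfer derivative of order $\mu$ and type $\nu$ is ${}^H\mathcal{D}^{\mu,\nu;\Psi}_{0^+}h(t)=I_{0^+}^{\nu(1-\mu);\Psi}\left(\frac{1}{\Psi'(t)}\frac{d}{dt}\right)I_{0^+}^{(1-\nu)(1-\mu);\Psi}h(t)$. *)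

theory Defs
  imports "HOL-Analysis.Analysis"
begin

text \<open>
  Functions on \<open>(0,T]\<close> and on \<open>J = [0,T]\<close> are total functions on the reals whose values outside
  these intervals are never used. The derivative of \<open>\<Psi>\<close> is passed as a separate argument \<open>\<psi>\<close>;
  derivatives are taken within \<open>{0..T}\<close>, hence one-sided at \<open>T\<close> and two-sided at interior points.
\<close>

definition weighted_continuous :: "real \<Rightarrow> (real \<Rightarrow> real) \<Rightarrow> real \<Rightarrow> (real \<Rightarrow> real) set" where
  "weighted_continuous T \<Psi> \<gamma> =
     {h. \<exists>g. continuous_on {0..T} g \<and> (\<forall>t\<in>{0<..T}. g t = (\<Psi> t - \<Psi> 0) powr \<gamma> * h t)}"

definition psi_frac_integrand ::
    "(real \<Rightarrow> real) \<Rightarrow> (real \<Rightarrow> real) \<Rightarrow> real \<Rightarrow> (real \<Rightarrow> real) \<Rightarrow> real \<Rightarrow> real \<Rightarrow> real" where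
  "psi_frac_integrand \<Psi> \<psi> \<alpha> h t s = \<psi> s * (\<Psi> t - \<Psi> s) powr (\<alpha> - 1) * h s"

definition psi_frac_int ::
    "(real \<Rightarrow> real) \<Rightarrow> (real \<Rightarrow> real) \<Rightarrow> real \<Rightarrow> (real \<Rightarrow> real) \<Rightarrow> real \<Rightarrow> real" where
  "psi_frac_int \<Psi> \<psi> \<alpha> h t =
     (if \<alpha> = 0 then h t
      else 1 / Gamma \<alpha> * (LBINT s:{0<..<t}. psi_frac_integrand \<Psi> \<psi> \<alpha> h t s))"

definition psi_deriv :: "real \<Rightarrow> (real \<Rightarrow> real) \<Rightarrow> (real \<Rightarrow> real) \<Rightarrow> real \<Rightarrow> real" where
  "psi_deriv T \<psi> h t = 1 / \<psi> t * vector_derivative h (at t within {0..T})"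

definition psi_hilfer_deriv ::
    "real \<Rightarrow> (real \<Rightarrow> real) \<Rightarrow> (real \<Rightarrow> real) \<Rightarrow> real \<Rightarrow> real \<Rightarrow> (real \<Rightarrow> real) \<Rightarrow> real \<Rightarrow> real" where
  "psi_hilfer_deriv T \<Psi> \<psi> \<mu> \<nu> h =
     psi_frac_int \<Psi> \<psi> (\<nu> * (1 - \<mu>))
       (psi_deriv T \<psi> (psi_frac_int \<Psi> \<psi> ((1 - \<nu>) * (1 - \<mu>)) h))"

text \<open>
  Existence of the derivative at \<open>t\<close>: all that the defining formula evaluates must exist. If the
  outer order \<open>\<nu> * (1 - \<mu>)\<close> is zero, the outer integral is the identity and only the derivative at
  \<open>t\<close> itself occurs; otherwise the derivative must exist on \<open>(0,t)\<close> and the outer integral must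
  converge. The inner integral needs no condition: it converges for every \<open>h\<close> in
  \<open>weighted_continuous T \<Psi> (1 - \<xi>)\<close>, as \<open>\<xi> > 0\<close>.
\<close>

definition psi_hilfer_deriv_exists ::
    "real \<Rightarrow> (real \<Rightarrow> real) \<Rightarrow> (real \<Rightarrow> real) \<Rightarrow> real \<Rightarrow> real \<Rightarrow> (real \<Rightarrow> real) \<Rightarrow> real \<Rightarrow> bool" where
  "psi_hilfer_deriv_exists T \<Psi> \<psi> \<mu> \<nu> h t \<longleftrightarrow>
     (let \<alpha> = \<nu> * (1 - \<mu>);
          g = psi_frac_int \<Psi> \<psi> ((1 - \<nu>) * (1 - \<mu>)) h
      in if \<alpha> = 0 then g differentiable (at t within {0..T})
         else (\<forall>s\<in>{0<..<t}. g differentiable (at s within {0..T})) \<and>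
              set_integrable lborel {0<..<t}
                (psi_frac_integrand \<Psi> \<psi> \<alpha> (psi_deriv T \<psi> g) t))"

end

theory Submission
  imports Defs
begin

text \<open>
  In the new time \<open>x = \<Psi> t - \<Psi> 0\<close>, put \<open>a = (1 - \<nu>) * (1 - \<mu>)\<close> and \<open>\<beta> = \<nu> * (1 - \<mu>)\<close>, so that
  \<open>a + \<beta> = 1 - \<mu>\<close>, let \<open>f\<close> be \<open>m\<close> in the new time, and write \<open>I\<^sup>p\<close> for the fractional integral and
  \<open>g = I\<^sup>a f\<close>, \<open>R = I\<^sup>\<beta> g = I\<^sup>1\<^sup>-\<^sup>\<mu> f\<close>. Suppose that \<open>I\<^sup>\<beta> g'\<close> is positive at \<open>x\<^sub>1\<close>.

  Integration by parts expresses \<open>R\<close> as \<open>g(0+)\<close> times a power plus \<open>I\<^sup>\<beta>\<^sup>+\<^sup>1 g'\<close>; since \<open>g(0+) \<ge> 0\<close>,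
  dominated convergence of the difference quotients gives \<open>R x \<le> R x\<^sub>1 - L * (x\<^sub>1 - x)\<close> with some \<open>L > 0\<close>
  for \<open>x\<close> slightly below \<open>x\<^sub>1\<close>.

  This contradicts \<open>f \<ge> 0\<close> and \<open>f x\<^sub>1 = 0\<close>. Because \<open>m\<close> is merely continuous, one cannot differentiate
  under the integral sign. Instead, restrict the fractional integral to \<open>[c, x\<^sub>1]\<close>: the contribution of
  \<open>[0, c]\<close> decreases, so the remaining part \<open>R\<^sub>2\<close> satisfies the same bound and \<open>M = R\<^sub>2 x\<^sub>1 > 0\<close>. Apply
  \<open>I\<^sup>\<mu>\<close> to return to the integral of \<open>f\<close>: over \<open>[x\<^sub>1 - h, x\<^sub>1]\<close> it is at least a positive
  multiple of \<open>M * h\<close> up to an error \<open>o(h)\<close>, whereas it is \<open>o(h)\<close> by continuity at \<open>x\<^sub>1\<close>.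
\<close>

section \<open>Beta integrals and the semigroup law of fractional integrals\<close>

text \<open>The affine substitution \<open>(s - u) / (t - u)\<close> reduces this to Euler's
  integral over the unit interval; the length \<open>d = t - u\<close> contributes one factor for
  each of the two powers and one for the measure.\<close>

lemma has_integral_beta_kernel:
  fixes p q u t :: real
  assumes "p > 0" "q > 0" "u < t"
  shows "((\<lambda>s. (t - s) powr (p - 1) * (s - u) powr (q - 1)) has_integral
           (t - u) powr (p + q - 1) * Beta q p) {u..t}"
proof -
  define d where "d = t - u"
  have d: "d > 0" using assms by (simp add: d_def)
  have "((\<lambda>x. ((1 / d) *\<^sub>R x + - u / d) powr (q - 1) * (1 - ((1 / d) *\<^sub>R x + - u / d)) powr (p - 1))
      has_integral (Beta q p /\<^sub>R (1 / d) ^ DIM(real)))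
      (cbox ((0 - - u / d) /\<^sub>R (1 / d)) ((1 - - u / d) /\<^sub>R (1 / d)))"
    using has_integral_Beta_real[OF assms(2,1)] d
    by (intro has_integral_affinity') auto
  moreover have "cbox ((0 - - u / d) /\<^sub>R (1 / d)) ((1 - - u / d) /\<^sub>R (1 / d)) = {u..t}"
    using d by (simp add: field_simps d_def)
  moreover have "(1 / d) *\<^sub>R x + - u / d = (x - u) / d"
    and "1 - (x - u) / d = (t - x) / d" for x
    using d by (simp_all add: diff_divide_distrib) (simp add: d_def field_simps)
  ultimately have
    "((\<lambda>x. ((x - u) / d) powr (q - 1) * ((t - x) / d) powr (p - 1)) has_integral d * Beta q p) {u..t}"
    using d by (simp only: ) (simp add: mult.commute)
  from has_integral_mult_right[OF this, of "d powr (p + q - 2)"]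
  have "((\<lambda>x. d powr (p + q - 2) * (((x - u) / d) powr (q - 1) * ((t - x) / d) powr (p - 1)))
      has_integral d powr (p + q - 2) * (d * Beta q p)) {u..t}" .
  moreover have "d powr (p + q - 2) * (d * Beta q p) = d powr (p + q - 1) * Beta q p"
    using d powr_mult_base[of d "p + q - 2"] by (simp add: algebra_simps)
  moreover have "d powr (p + q - 2) * (((x - u) / d) powr (q - 1) * ((t - x) / d) powr (p - 1)) =
      (t - x) powr (p - 1) * (x - u) powr (q - 1)" if "x \<in> {u..t}" for x
  proof -
    have "p + q - 2 = (p - 1) + (q - 1)" by simp
    then have "d powr (p + q - 2) = d powr (p - 1) * d powr (q - 1)"
      by (metis powr_add)
    then show ?thesis
      using d that by (simp add: powr_divide)
  qed
  ultimately show ?thesis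
    unfolding d_def by (metis (no_types, lifting) has_integral_eq)
qed

text \<open>Tonelli on the triangle \<open>c \<le> u \<le> s \<le> t\<close>, whose inner integral
  over \<open>s\<close> is the Beta kernel. This is the law
  \<open>I\<^sup>p I\<^sup>q = I\<^sup>p\<^sup>+\<^sup>q\<close> with lower limit \<open>c\<close>
  and without the Gamma normalisations, whence the factor \<open>Beta q p\<close>.\<close>

lemma has_integral_frac_semigroup:
  fixes p q c t I :: real and f R :: "real \<Rightarrow> real"
  assumes p: "p > 0" and q: "q > 0" and "c \<le> t"
    and f [measurable]: "f \<in> borel_measurable borel" and nonneg: "\<And>x. f x \<ge> 0"
    and R: "\<And>s. s \<in> {c<..<t} \<Longrightarrow> ((\<lambda>u. (s - u) powr (q - 1) * f u) has_integral R s) {c..s}"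
    and I: "((\<lambda>u. (t - u) powr (p + q - 1) * f u) has_integral I) {c..t}"
  shows "((\<lambda>s. (t - s) powr (p - 1) * R s) has_integral Beta q p * I) {c..t}"
proof -
  \<comment> \<open>\<open>N\<close> extends \<open>R\<close> to a function on the whole line that
    is measurable by construction. The cutoffs are written as factors so that the integrand is
    jointly measurable in \<open>s\<close> and \<open>u\<close>.\<close>
  define N where "N s = (\<integral>\<^sup>+u. ennreal ((s - u) powr (q - 1) * f u) * indicator {c..} u * (if u \<le> s then 1 else 0) \<partial>lborel)" for s
  have [measurable]: "N \<in> borel_measurable borel"
    unfolding N_def by measurable
  have N: "N s = ennreal (R s)" if "s \<in> {c<..<t}" for s
  proof -
    have "N s = (\<integral>\<^sup>+u. ennreal ((s - u) powr (q - 1) * f u) * indicator {c..s} u \<partial>lborel)"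
      unfolding N_def by (intro nn_integral_cong) (auto simp: indicator_def)
    also have "\<dots> = ennreal (R s)"
      using R[OF that] nonneg by (intro nn_integral_has_integral_lebesgue') auto
    finally show ?thesis .
  qed
  have R0: "R s \<ge> 0" if "s \<in> {c<..<t}" for s
    using R[OF that] nonneg by (auto intro: has_integral_nonneg)
  have I0: "I \<ge> 0" using I nonneg by (auto intro: has_integral_nonneg)
  have B0: "Beta q p \<ge> 0"
    using p q by (simp add: Beta_def Gamma_real_pos less_imp_le)
  define F where "F s = indicator {c<..<t} s * ((t - s) powr (p - 1) * enn2real (N s))" for s
  have "(\<integral>\<^sup>+s. ennreal (F s) \<partial>lborel) =
        (\<integral>\<^sup>+s. ennreal (indicator {c<..<t} s * (t - s) powr (p - 1)) * N s \<partial>lborel)"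
    by (intro nn_integral_cong) (auto simp: F_def indicator_def N R0 ennreal_mult)
  also have "\<dots> = (\<integral>\<^sup>+s. \<integral>\<^sup>+u. ennreal (indicator {c<..<t} s * (t - s) powr (p - 1)) *
      (ennreal ((s - u) powr (q - 1) * f u) * indicator {c..} u * (if u \<le> s then 1 else 0)) \<partial>lborel \<partial>lborel)"
    unfolding N_def by (intro nn_integral_cong nn_integral_cmult[symmetric]) auto
  also have "\<dots> = (\<integral>\<^sup>+u. \<integral>\<^sup>+s. ennreal (indicator {c<..<t} s * (t - s) powr (p - 1)) *
      (ennreal ((s - u) powr (q - 1) * f u) * indicator {c..} u * (if u \<le> s then 1 else 0)) \<partial>lborel \<partial>lborel)"
    by (rule lborel_pair.Fubini') measurable
  also have "\<dots> = (\<integral>\<^sup>+u. ennreal (Beta q p) * (ennreal ((t - u) powr (p + q - 1) * f u) * indicator {c..t} u) \<partial>lborel)"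
  proof (rule nn_integral_cong_AE)
    have "AE u in lborel. u \<noteq> c \<and> u \<noteq> t"
      using AE_lborel_singleton[of c] AE_lborel_singleton[of t] by eventually_elim auto
    then show "AE u in lborel. (\<integral>\<^sup>+s. ennreal (indicator {c<..<t} s * (t - s) powr (p - 1)) *
      (ennreal ((s - u) powr (q - 1) * f u) * indicator {c..} u * (if u \<le> s then 1 else 0)) \<partial>lborel) =
      ennreal (Beta q p) * (ennreal ((t - u) powr (p + q - 1) * f u) * indicator {c..t} u)"
    proof eventually_elim
      case (elim u)
      show ?case
      proof (cases "c < u \<and> u < t")
        case True
        have "(\<integral>\<^sup>+s. ennreal (indicator {c<..<t} s * (t - s) powr (p - 1)) *
          (ennreal ((s - u) powr (q - 1) * f u) * indicator {c..} u * (if u \<le> s then 1 else 0)) \<partial>lborel) =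
          (\<integral>\<^sup>+s. ennreal (f u) * (ennreal ((t - s) powr (p - 1) * (s - u) powr (q - 1)) * indicator {u..t} s) \<partial>lborel)"
          using True nonneg
          by (intro nn_integral_cong) (auto simp: indicator_def ennreal_mult[symmetric] mult_ac)
        also have "\<dots> = ennreal (f u) * ennreal ((t - u) powr (p + q - 1) * Beta q p)"
          using has_integral_beta_kernel[OF p q, of u t] True
          by (subst nn_integral_cmult, simp, subst nn_integral_has_integral_lebesgue'[where I="(t - u) powr (p + q - 1) * Beta q p"]) auto
        also have "\<dots> = ennreal (Beta q p) * (ennreal ((t - u) powr (p + q - 1) * f u) * indicator {c..t} u)"
          using True nonneg B0 by (simp add: ennreal_mult[symmetric] mult_ac)
        finally show ?thesis .
      next
        case False
        with elim have "u < c \<or> u > t" by auto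
        then show ?thesis
          by (subst nn_integral_cong[where v = "\<lambda>_. 0"]) (auto simp: indicator_def)
      qed
    qed
  qed
  also have "\<dots> = ennreal (Beta q p) * (\<integral>\<^sup>+u. ennreal ((t - u) powr (p + q - 1) * f u) * indicator {c..t} u \<partial>lborel)"
    by (rule nn_integral_cmult) auto
  also have "\<dots> = ennreal (Beta q p * I)"
    using I nonneg I0 B0 by (subst nn_integral_has_integral_lebesgue'[where I=I]) (auto simp: ennreal_mult)
  finally have "(F has_integral Beta q p * I) UNIV"
    using I0 B0 by (intro nn_integral_has_integral) (auto simp: F_def[abs_def])
  then have "((\<lambda>s. if s \<in> {c<..<t} then (t - s) powr (p - 1) * R s else 0) has_integral Beta q p * I) UNIV"
    by (rule has_integral_eq[rotated]) (auto simp: F_def N R0)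
  then have "((\<lambda>s. (t - s) powr (p - 1) * R s) has_integral Beta q p * I) {c<..<t}"
    by (simp only: has_integral_restrict_UNIV)
  then show ?thesis
    by (simp add: has_integral_Icc_iff_Ioo)
qed

section \<open>Comparison of integrals and elementary estimates for powers\<close>

text \<open>Endpoints are null sets. They must be left out of the comparison because a singular
  kernel takes the default value \<open>0 powr p = 0\<close> there, which breaks pointwise
  inequalities.\<close>

lemma integral_le_Ioo:
  fixes f g :: "real \<Rightarrow> real"
  assumes "f integrable_on {a..b}" "g integrable_on {a..b}"
    and "\<And>x. x \<in> {a<..<b} \<Longrightarrow> f x \<le> g x"
  shows "integral {a..b} f \<le> integral {a..b} g"
  using assms unfolding integral_open_interval_real integrable_on_Icc_iff_Ioo
  by (intro integral_le) auto

lemma has_integral_powr_diff: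
  fixes p c d t :: real
  assumes "p > 0" "c \<le> d" "d \<le> t"
  shows "((\<lambda>s. (t - s) powr (p - 1)) has_integral ((t - c) powr p - (t - d) powr p) / p) {c..d}"
proof -
  have "((\<lambda>s. (t - s) powr (p - 1)) has_integral
          - ((t - d) powr p / p) - - ((t - c) powr p / p)) {c..d}"
  proof (rule fundamental_theorem_of_calculus_interior)
    show "continuous_on {c..d} (\<lambda>s. - ((t - s) powr p / p))"
      using assms by (intro continuous_intros continuous_on_powr') auto
    show "((\<lambda>s. - ((t - s) powr p / p)) has_vector_derivative (t - s) powr (p - 1)) (at s)"
      if "s \<in> {c<..<d}" for s
      using that assms unfolding has_real_derivative_iff_has_vector_derivative[symmetric]
      by (auto intro!: derivative_eq_intros)
  qed (use assms in auto)
  then show ?thesis by (simp add: diff_divide_distrib)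
qed

text \<open>Mean value theorem, with the derivative of \<open>z powr p\<close> decreasing. The bound
  is linear in \<open>h\<close>; this is what later beats an error of order
  \<open>o(h)\<close>.\<close>

lemma powr_diff_ge:
  fixes p d h :: real
  assumes "0 < p" "p < 1" "0 < h" "h < d"
  shows "p * d powr (p - 1) * h \<le> d powr p - (d - h) powr p"
proof -
  have "\<exists>z>d - h. z < d \<and> d powr p - (d - h) powr p = (d - (d - h)) * (p * z powr (p - 1))"
    using assms by (intro MVT2) (auto intro!: derivative_eq_intros)
  then obtain z where z: "d - h < z" "z < d" "d powr p - (d - h) powr p = h * (p * z powr (p - 1))"
    by auto
  have "d powr (p - 1) \<le> z powr (p - 1)"
    using z assms by (intro powr_mono2') auto
  then have "h * (p * d powr (p - 1)) \<le> h * (p * z powr (p - 1))"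
    using assms by (intro mult_left_mono) auto
  then show ?thesis using z by (simp add: mult_ac)
qed

section \<open>Fractional integrals of a nonnegative function with left limit zero do not grow
  linearly\<close>

text \<open>The semigroup law with orders \<mu> and 1 - \<mu> recovers the plain integral of
  \<open>f\<close> from the truncated \<open>R2\<close>. Subtracting this identity at
  \<open>y\<close> from the one at \<open>x\<^sub>1\<close> expresses \<open>B\<close> times the
  integral of \<open>f\<close> over \<open>[y, x\<^sub>1]\<close> as a part near
  \<open>x\<^sub>1\<close> plus a far part over \<open>[c, y]\<close>. Lower bounds for both
  contradict the smallness of \<open>f\<close>.\<close>

lemma frac_integral_no_left_growth:
  fixes \<mu> x\<^sub>1 L :: real and f R :: "real \<Rightarrow> real"
  assumes \<mu>: "0 < \<mu>" "\<mu> < 1" and x1: "0 < x\<^sub>1"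
    and f: "f \<in> borel_measurable borel" and nonneg: "\<And>x. f x \<ge> 0"
    and lim: "(f \<longlongrightarrow> 0) (at_left x\<^sub>1)"
    and R: "\<And>x. 0 < x \<Longrightarrow> x \<le> x\<^sub>1 \<Longrightarrow> ((\<lambda>s. (x - s) powr - \<mu> * f s) has_integral R x) {0..x}"
    and L: "L > 0" and growth: "\<forall>\<^sub>F x in at_left x\<^sub>1. R x \<le> R x\<^sub>1 - L * (x\<^sub>1 - x)"
  shows False
proof -
  have "\<forall>\<^sub>F x in at_left x\<^sub>1. f x < 1"
    using lim by (rule order_tendstoD) simp
  with growth have "\<forall>\<^sub>F x in at_left x\<^sub>1. R x \<le> R x\<^sub>1 - L * (x\<^sub>1 - x) \<and> f x < 1"
    by eventually_elim auto
  then obtain b where b: "b < x\<^sub>1"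
    "\<And>x. b < x \<Longrightarrow> x < x\<^sub>1 \<Longrightarrow> R x \<le> R x\<^sub>1 - L * (x\<^sub>1 - x) \<and> f x < 1"
    unfolding eventually_at_left_field by blast
  \<comment> \<open>Any point of \<open>(max b 0, x\<^sub>1)\<close> would do: beyond
    \<open>c\<close> both the growth bound and \<open>f < 1\<close> hold, the latter making
    \<open>f\<close> itself integrable.\<close>
  define c where "c = (max b 0 + x\<^sub>1) / 2"
  have c: "0 < c" "c < x\<^sub>1" "b < c" using b x1 by (auto simp: c_def)
  define k where "k x s = (x - s) powr - \<mu> * f s" for x s
  have k_int: "k x integrable_on {0..x}" if "0 < x" "x \<le> x\<^sub>1" for x
    using R[OF that] unfolding k_def by blast
  have k_sub: "k x integrable_on {a..d}" if "0 < x" "x \<le> x\<^sub>1" "0 \<le> a" "d \<le> x" for x a d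
    using k_int[OF that(1,2)] by (rule integrable_on_subinterval) (use that in auto)
  define R2 where "R2 x = integral {c..x} (k x)" for x
  have R2_nonneg: "R2 x \<ge> 0" if "x \<in> {c..x\<^sub>1}" for x
    unfolding R2_def using that c nonneg by (intro integral_nonneg k_sub) (auto simp: k_def)
  have R_split: "R x = integral {0..c} (k x) + R2 x" if "x \<in> {c..x\<^sub>1}" for x
  proof -
    have "R x = integral {0..x} (k x)"
      using R[of x] that c unfolding k_def by (simp add: integral_unique)
    then show ?thesis
      unfolding R2_def using that c by (subst Henstock_Kurzweil_Integration.integral_combine) (auto intro: k_int)
  qed
  \<comment> \<open>The exponent is negative, so for fixed \<open>s\<close> the kernel decreases in
    \<open>x\<close>. Hence the contribution of \<open>[0, c]\<close> to \<open>R\<close> does not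
    increase towards \<open>x\<^sub>1\<close>, and all growth of \<open>R\<close> must come from
    \<open>R2\<close>.\<close>
  have k_mono: "k x\<^sub>1 s \<le> k x s" if "s < x" "x \<le> x\<^sub>1" for x s
    unfolding k_def using that \<mu> nonneg by (intro mult_right_mono powr_mono2') auto
  have R2_le: "R2 x \<le> R2 x\<^sub>1 - L * (x\<^sub>1 - x)" if "x \<in> {c<..<x\<^sub>1}" for x
  proof -
    have "integral {0..c} (k x\<^sub>1) \<le> integral {0..c} (k x)"
      using that c by (intro integral_le k_sub k_mono) auto
    then show ?thesis
      using b(2)[of x] R_split[of x] R_split[of x\<^sub>1] that c by simp
  qed
  define M where "M = R2 x\<^sub>1"
  have M: "M > 0"
  proof -
    have "R2 ((c + x\<^sub>1) / 2) \<le> M - L * (x\<^sub>1 - (c + x\<^sub>1) / 2)"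
      unfolding M_def using c by (intro R2_le) auto
    moreover have "R2 ((c + x\<^sub>1) / 2) \<ge> 0" using c by (intro R2_nonneg) auto
    moreover have "L * (x\<^sub>1 - (c + x\<^sub>1) / 2) > 0" using c L by simp
    ultimately show ?thesis by linarith
  qed
  have R2_le_M: "R2 x \<le> M" if "x \<in> {c<..<x\<^sub>1}" for x
    using R2_le[OF that] that L by (smt (verit) M_def greaterThanLessThan_iff mult_nonneg_nonneg)
  have f_int: "f integrable_on {c..t}" if "t \<le> x\<^sub>1" for t
  proof -
    have "f \<in> borel_measurable (lebesgue_on {c<..<x\<^sub>1})"
      using f by (intro measurable_restrict_space1 measurable_completion) simp
    moreover have "{c<..<x\<^sub>1} \<in> sets lebesgue" by simp
    moreover have "(\<lambda>_. 1 :: real) integrable_on {c<..<x\<^sub>1}"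
      unfolding integrable_on_Icc_iff_Ioo[symmetric] by (rule integrable_const_ivl)
    moreover have "norm (f x) \<le> 1" if "x \<in> {c<..<x\<^sub>1}" for x
      using b(2)[of x] c nonneg[of x] that by auto
    ultimately have "f absolutely_integrable_on {c<..<x\<^sub>1}"
      by (rule measurable_bounded_by_integrable_imp_absolutely_integrable)
    then have "f integrable_on {c<..<x\<^sub>1}"
      by (rule set_lebesgue_integral_eq_integral)
    then have "f integrable_on {c..x\<^sub>1}" by (simp add: integrable_on_Icc_iff_Ioo)
    then show ?thesis by (rule integrable_on_subinterval) (use that in auto)
  qed
  define B where "B = Beta (1 - \<mu>) \<mu>"
  have B: "B > 0" unfolding B_def Beta_def using \<mu> by (simp add: Gamma_real_pos)
  have semigroup: "((\<lambda>s. (t - s) powr (\<mu> - 1) * R2 s) has_integral B * integral {c..t} f) {c..t}"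
    if t: "t \<in> {c<..x\<^sub>1}" for t
    unfolding B_def
  proof (rule has_integral_frac_semigroup[OF _ _ _ f nonneg])
    show "((\<lambda>u. (s - u) powr (1 - \<mu> - 1) * f u) has_integral R2 s) {c..s}" if "s \<in> {c<..<t}" for s
      using k_sub[of s c s] that t c unfolding R2_def k_def by (auto simp: has_integral_integral)
    \<comment> \<open>The exponents add up to zero, so the kernel is 1 except at
      \<open>u = t\<close>, where \<open>0 powr 0 = 0\<close>; this single point is
      discarded.\<close>
    have "(f has_integral integral {c..t} f) {c..t}"
      using f_int t by (auto simp: has_integral_integral[symmetric])
    then show "((\<lambda>u. (t - u) powr (\<mu> + (1 - \<mu>) - 1) * f u) has_integral integral {c..t} f) {c..t}"
      by (rule has_integral_spike[of "{t}", rotated 2]) auto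
  qed (use \<mu> t in auto)
  define d where "d = x\<^sub>1 - c"
  have d: "d > 0" using c by (simp add: d_def)
  \<comment> \<open>\<open>M * d powr (\<mu> - 1)\<close> is the slope in \<open>h\<close> gained
    from \<open>M\<close>, and \<open>e\<close> makes \<open>C * e\<close> half of it. In
    \<open>C\<close>, the summand \<open>B\<close> stems from bounding the integral of
    \<open>f\<close> by \<open>h * e\<close>, and \<open>1 / (1 - \<mu>)\<close> from the error in
    the lower bound for \<open>R2\<close>.\<close>
  define C where "C = B + 1 / (1 - \<mu>)"
  have C: "C > 0" using B \<mu> by (simp add: C_def add_pos_pos)
  define e where "e = M * d powr (\<mu> - 1) / (2 * C)"
  have e: "e > 0" using M d C by (simp add: e_def)
  have "\<forall>\<^sub>F x in at_left x\<^sub>1. f x < e"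
    using lim e by (rule order_tendstoD)
  then obtain b' where b': "b' < x\<^sub>1" "\<And>x. b' < x \<Longrightarrow> x < x\<^sub>1 \<Longrightarrow> f x < e"
    unfolding eventually_at_left_field by blast
  define y where "y = (max b' c + x\<^sub>1) / 2"
  have y: "c < y" "y < x\<^sub>1" "b' < y" using b' c by (auto simp: y_def)
  define h where "h = x\<^sub>1 - y"
  have h: "0 < h" "h < d" using y by (auto simp: h_def d_def)
  \<comment> \<open>Split \<open>M\<close> at \<open>s\<close>: on \<open>[c, s]\<close> the kernel
    for \<open>x\<^sub>1\<close> lies below the one for \<open>s\<close>, and on
    \<open>[s, x\<^sub>1]\<close> the function \<open>f\<close> is below \<open>e\<close>.\<close>
  have R2_ge: "M - e * ((x\<^sub>1 - s) powr (1 - \<mu>) / (1 - \<mu>)) \<le> R2 s" if s: "s \<in> {y<..<x\<^sub>1}" for s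
  proof -
    have "M = integral {c..s} (k x\<^sub>1) + integral {s..x\<^sub>1} (k x\<^sub>1)"
      unfolding M_def R2_def using s y c
      by (subst Henstock_Kurzweil_Integration.integral_combine) (auto intro: k_sub)
    moreover have "integral {c..s} (k x\<^sub>1) \<le> R2 s"
      unfolding R2_def using s y c by (intro integral_le_Ioo k_sub k_mono) auto
    moreover have "integral {s..x\<^sub>1} (k x\<^sub>1) \<le> integral {s..x\<^sub>1} (\<lambda>u. e * (x\<^sub>1 - u) powr (1 - \<mu> - 1))"
    proof (rule integral_le_Ioo)
      show "k x\<^sub>1 integrable_on {s..x\<^sub>1}" using s y c by (intro k_sub) auto
      show "(\<lambda>u. e * (x\<^sub>1 - u) powr (1 - \<mu> - 1)) integrable_on {s..x\<^sub>1}"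
        using has_integral_powr_diff[of "1 - \<mu>" s x\<^sub>1 x\<^sub>1] \<mu> s
        by (intro integrable_on_mult_right) auto
      show "k x\<^sub>1 u \<le> e * (x\<^sub>1 - u) powr (1 - \<mu> - 1)" if "u \<in> {s<..<x\<^sub>1}" for u
        using b'(2)[of u] that s y unfolding k_def by (auto intro!: mult_right_mono simp: mult.commute)
    qed
    moreover have "integral {s..x\<^sub>1} (\<lambda>u. e * (x\<^sub>1 - u) powr (1 - \<mu> - 1)) = e * ((x\<^sub>1 - s) powr (1 - \<mu>) / (1 - \<mu>))"
      using has_integral_powr_diff[of "1 - \<mu>" s x\<^sub>1 x\<^sub>1] \<mu> s
      by (subst integral_mult_right) (auto dest: integral_unique)
    ultimately show ?thesis by linarith
  qed
  define w where "w t s = (t - s) powr (\<mu> - 1)" for t s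
  have w_int: "(w t has_integral ((t - u) powr \<mu> - (t - v) powr \<mu>) / \<mu>) {u..v}"
    if "u \<le> v" "v \<le> t" for t u v
    unfolding w_def using has_integral_powr_diff[OF \<mu>(1) that] .
  have sg: "((\<lambda>s. w t s * R2 s) has_integral B * integral {c..t} f) {c..t}"
    if "t \<in> {c<..x\<^sub>1}" for t
    unfolding w_def using semigroup[OF that] .
  have w_sub: "(\<lambda>s. w x\<^sub>1 s * R2 s) integrable_on {u..v}" if "c \<le> u" "v \<le> x\<^sub>1" for u v
    by (rule integrable_on_subinterval[of _ "{c..x\<^sub>1}"]) (use sg[of x\<^sub>1] c that in auto)
  \<comment> \<open>The weight cancels the power in the error of \<open>R2_ge\<close>, which leaves
    the constant \<open>e / (1 - \<mu>)\<close>.\<close>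
  have near: "integral {y..x\<^sub>1} (\<lambda>s. M * w x\<^sub>1 s - e / (1 - \<mu>)) \<le> integral {y..x\<^sub>1} (\<lambda>s. w x\<^sub>1 s * R2 s)"
  proof (rule integral_le_Ioo)
    show "(\<lambda>s. M * w x\<^sub>1 s - e / (1 - \<mu>)) integrable_on {y..x\<^sub>1}"
      using w_int[of y x\<^sub>1 x\<^sub>1] y by (intro integrable_diff integrable_on_mult_right) auto
    show "M * w x\<^sub>1 s - e / (1 - \<mu>) \<le> w x\<^sub>1 s * R2 s" if s: "s \<in> {y<..<x\<^sub>1}" for s
    proof -
      have "w x\<^sub>1 s * (M - e * ((x\<^sub>1 - s) powr (1 - \<mu>) / (1 - \<mu>))) \<le> w x\<^sub>1 s * R2 s"
        using R2_ge[OF s] by (intro mult_left_mono) (auto simp: w_def)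
      moreover have "w x\<^sub>1 s * (x\<^sub>1 - s) powr (1 - \<mu>) = 1"
        using s unfolding w_def by (simp add: powr_add[symmetric])
      ultimately show ?thesis by (simp add: algebra_simps)
    qed
  qed (use w_sub y in auto)
  \<comment> \<open>Here the difference of the weights is nonpositive, so the upper bound
    \<open>R2 \<le> M\<close> gives a lower bound.\<close>
  have far: "integral {c..y} (\<lambda>s. M * (w x\<^sub>1 s - w y s)) \<le> integral {c..y} (\<lambda>s. w x\<^sub>1 s * R2 s - w y s * R2 s)"
  proof (rule integral_le_Ioo)
    show "(\<lambda>s. M * (w x\<^sub>1 s - w y s)) integrable_on {c..y}"
      using w_int[of c y x\<^sub>1] w_int[of c y y] y by (intro integrable_diff integrable_on_mult_right) auto
    show "(\<lambda>s. w x\<^sub>1 s * R2 s - w y s * R2 s) integrable_on {c..y}"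
      using w_sub[of c y] sg[of y] y by (intro integrable_diff) auto
    show "M * (w x\<^sub>1 s - w y s) \<le> w x\<^sub>1 s * R2 s - w y s * R2 s" if s: "s \<in> {c<..<y}" for s
    proof -
      have "w x\<^sub>1 s \<le> w y s"
        unfolding w_def using s y \<mu> by (intro powr_mono2') auto
      then have "(w x\<^sub>1 s - w y s) * M \<le> (w x\<^sub>1 s - w y s) * R2 s"
        using R2_le_M[of s] s y by (intro mult_left_mono_neg) auto
      then show ?thesis by (simp add: algebra_simps)
    qed
  qed
  have near_val: "integral {y..x\<^sub>1} (\<lambda>s. M * w x\<^sub>1 s - e / (1 - \<mu>)) = M * (h powr \<mu> / \<mu>) - h * (e / (1 - \<mu>))"
    using has_integral_diff[OF has_integral_mult_right[OF w_int[of y x\<^sub>1 x\<^sub>1], of M] has_integral_const_real[of "e / (1 - \<mu>)" y x\<^sub>1]] y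
    by (auto simp: h_def dest!: integral_unique)
  have far_val: "integral {c..y} (\<lambda>s. M * (w x\<^sub>1 s - w y s)) = M * ((d powr \<mu> - h powr \<mu>) / \<mu> - (d - h) powr \<mu> / \<mu>)"
    using has_integral_mult_right[OF has_integral_diff[OF w_int[of c y x\<^sub>1] w_int[of c y y]], of M] y
    by (auto simp: h_def d_def dest!: integral_unique)
  have "integral {c..x\<^sub>1} (\<lambda>s. w x\<^sub>1 s * R2 s) =
        integral {c..y} (\<lambda>s. w x\<^sub>1 s * R2 s) + integral {y..x\<^sub>1} (\<lambda>s. w x\<^sub>1 s * R2 s)"
    using y w_sub by (subst Henstock_Kurzweil_Integration.integral_combine) auto
  moreover have "integral {c..y} (\<lambda>s. w x\<^sub>1 s * R2 s - w y s * R2 s) =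
        integral {c..y} (\<lambda>s. w x\<^sub>1 s * R2 s) - integral {c..y} (\<lambda>s. w y s * R2 s)"
    using w_sub[of c y] sg[of y] y by (intro integral_diff) auto
  moreover have "integral {c..x\<^sub>1} (\<lambda>s. w x\<^sub>1 s * R2 s) = B * integral {c..x\<^sub>1} f"
    and "integral {c..y} (\<lambda>s. w y s * R2 s) = B * integral {c..y} f"
    using sg[of x\<^sub>1] sg[of y] y c by (auto dest: integral_unique)
  moreover have "integral {c..x\<^sub>1} f = integral {c..y} f + integral {y..x\<^sub>1} f"
    using y f_int by (subst Henstock_Kurzweil_Integration.integral_combine) auto
  ultimately have "integral {c..y} (\<lambda>s. w x\<^sub>1 s * R2 s - w y s * R2 s) + integral {y..x\<^sub>1} (\<lambda>s. w x\<^sub>1 s * R2 s)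
      = B * integral {y..x\<^sub>1} f"
    by (simp add: algebra_simps)
  moreover have "B * integral {y..x\<^sub>1} f \<le> B * (h * e)"
  proof -
    have "integral {y..x\<^sub>1} f \<le> integral {y..x\<^sub>1} (\<lambda>_. e)"
      using b'(2) y integrable_on_subinterval[OF f_int[of x\<^sub>1], of y x\<^sub>1]
      by (intro integral_le_Ioo) (auto simp: less_imp_le)
    also have "\<dots> = h * e" using y by (simp add: h_def)
    finally show ?thesis using B by (intro mult_left_mono) auto
  qed
  \<comment> \<open>The terms with \<open>h powr \<mu>\<close> from the two parts cancel, leaving an
    increment of \<open>powr\<close> at \<open>d\<close>, away from its singularity.\<close>
  ultimately have "M * ((d powr \<mu> - h powr \<mu>) / \<mu> - (d - h) powr \<mu> / \<mu>) +
      (M * (h powr \<mu> / \<mu>) - h * (e / (1 - \<mu>))) \<le> B * (h * e)"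
    using near far near_val far_val by linarith
  then have "M * (d powr \<mu> - (d - h) powr \<mu>) / \<mu> \<le> h * (C * e)"
    by (simp add: C_def algebra_simps add_divide_distrib diff_divide_distrib)
  then have "M * (d powr \<mu> - (d - h) powr \<mu>) \<le> \<mu> * (h * (C * e))"
    using \<mu> by (simp add: pos_divide_le_eq mult.commute)
  moreover have "M * (\<mu> * d powr (\<mu> - 1) * h) \<le> M * (d powr \<mu> - (d - h) powr \<mu>)"
    using powr_diff_ge[OF \<mu> h] M by (intro mult_left_mono) auto
  moreover have "M * (\<mu> * d powr (\<mu> - 1) * h) = \<mu> * (h * (M * d powr (\<mu> - 1)))"
    by simp
  ultimately have "\<mu> * (h * (M * d powr (\<mu> - 1))) \<le> \<mu> * (h * (C * e))"
    by linarith
  then have "h * (M * d powr (\<mu> - 1)) \<le> h * (C * e)"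
    using \<mu> by simp
  then have "M * d powr (\<mu> - 1) \<le> C * e"
    using h by simp
  also have "C * e = M * d powr (\<mu> - 1) / 2"
    using C by (simp add: e_def)
  finally show False using M d by simp
qed

section \<open>Left growth from a positive fractional integral of the derivative\<close>

text \<open>Since \<open>x powr p = x * x powr (p - 1)\<close> and the second factor decreases, the
  increment is at most \<open>h * x powr (p - 1)\<close>. The bound is uniform in \<open>h\<close>
  and serves as the dominating kernel below.\<close>

lemma powr_diff_quotient_le:
  fixes p h x :: real
  assumes "0 < p" "p < 1" "0 < h" "0 < x"
  shows "\<bar>(x powr p - max 0 (x - h) powr p) / h\<bar> \<le> x powr (p - 1)"
proof -
  have eq: "y powr p = y * y powr (p - 1)" if "y > 0" for y
    using that powr_mult_base[of y "p - 1"] by simp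
  have "x powr p - max 0 (x - h) powr p \<le> h * x powr (p - 1)"
  proof (cases "x \<le> h")
    case True
    then show ?thesis using assms eq[of x] by (auto simp: mult_right_mono max_def)
  next
    case False
    then have "(x - h) * x powr (p - 1) \<le> (x - h) * (x - h) powr (p - 1)"
      using assms by (intro mult_left_mono powr_mono2') auto
    then show ?thesis using False assms eq[of x] eq[of "x - h"] by (simp add: algebra_simps max_def)
  qed
  moreover have "max 0 (x - h) powr p \<le> x powr p"
    using assms by (intro powr_mono2) auto
  ultimately show ?thesis using assms by (simp add: field_simps)
qed

text \<open>Integration by parts moves the kernel onto \<open>D\<close>, with \<open>P\<close> the
  part of \<open>\<beta> * R\<close> that remains after the boundary term. The left difference
  quotients of \<open>P\<close> at \<open>x\<^sub>1\<close> converge to \<beta> times the integral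
  of \<open>E\<close>, and the boundary term can only help since \<open>g\<close> has a nonnegative
  limit at 0.\<close>

lemma frac_integral_left_growth:
  fixes \<beta> x\<^sub>1 :: real and g D R :: "real \<Rightarrow> real"
  defines "E \<equiv> \<lambda>s. (x\<^sub>1 - s) powr (\<beta> - 1) * D s"
  assumes \<beta>: "0 < \<beta>" "\<beta> < 1" and x1: "0 < x\<^sub>1"
    and nonneg: "\<And>x. x \<in> {0<..<x\<^sub>1} \<Longrightarrow> g x \<ge> 0"
    and deriv: "\<And>x. x \<in> {0<..<x\<^sub>1} \<Longrightarrow> (g has_real_derivative D x) (at x)"
    and E: "E absolutely_integrable_on {0<..<x\<^sub>1}"
    and pos: "integral {0<..<x\<^sub>1} E > 0"
    and R: "\<And>x. x \<in> {0<..x\<^sub>1} \<Longrightarrow> ((\<lambda>s. (x - s) powr (\<beta> - 1) * g s) has_integral R x) {0..x}"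
  shows "\<exists>L>0. \<forall>\<^sub>F x in at_left x\<^sub>1. R x \<le> R x\<^sub>1 - L * (x\<^sub>1 - x)"
proof -
  \<comment> \<open>Multiplying \<open>E\<close> by the bounded inverse of its kernel gives back
    \<open>D\<close>. So \<open>D\<close> is integrable down to 0, and \<open>g\<close> has a limit
    there.\<close>
  have "(\<lambda>s. (x\<^sub>1 - s) powr (1 - \<beta>) * E s) absolutely_integrable_on {0<..<x\<^sub>1}"
  proof (rule absolutely_integrable_bounded_measurable_product_real[OF _ _ _ E])
    have cont: "continuous_on {0..x\<^sub>1} (\<lambda>s. (x\<^sub>1 - s) powr (1 - \<beta>))"
      using \<beta> by (intro continuous_on_powr' continuous_intros) auto
    show "(\<lambda>s. (x\<^sub>1 - s) powr (1 - \<beta>)) \<in> borel_measurable (lebesgue_on {0<..<x\<^sub>1})"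
      by (intro continuous_imp_measurable_on_sets_lebesgue continuous_on_subset[OF cont]) auto
    show "bounded ((\<lambda>s. (x\<^sub>1 - s) powr (1 - \<beta>)) ` {0<..<x\<^sub>1})"
      using compact_imp_bounded[OF compact_continuous_image[OF cont compact_Icc]]
      by (rule bounded_subset) auto
  qed auto
  then have "(\<lambda>s. (x\<^sub>1 - s) powr (1 - \<beta>) * E s) integrable_on {0<..<x\<^sub>1}"
    by (rule set_lebesgue_integral_eq_integral)
  moreover have "(x\<^sub>1 - s) powr (1 - \<beta>) * E s = D s" if "s \<in> {0<..<x\<^sub>1}" for s
    using that unfolding E_def by (simp add: mult.assoc[symmetric] powr_add[symmetric])
  ultimately have "D integrable_on {0<..<x\<^sub>1}"
    by (rule integrable_eq)
  then have D_int: "D integrable_on {0..x\<^sub>1}"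
    by (simp add: integrable_on_Icc_iff_Ioo)
  define c where "c = x\<^sub>1 / 2"
  \<comment> \<open>The continuous extension of \<open>g\<close> to the closed interval, normalised
    to agree with \<open>g\<close> at the interior point \<open>c\<close>, because nothing is known
    about \<open>g\<close> at the endpoints.\<close>
  define G where "G x = g c - integral {0..c} D + integral {0..x} D" for x
  have G_cont: "continuous_on {0..x\<^sub>1} G"
    unfolding G_def by (intro continuous_intros indefinite_integral_continuous_1 D_int)
  have FTC: "integral {u..v} D = g v - g u" if "0 < u" "u \<le> v" "v < x\<^sub>1" for u v
  proof -
    have "(D has_integral g v - g u) {u..v}"
      using that deriv
      by (intro fundamental_theorem_of_calculus)
        (auto simp: has_real_derivative_iff_has_vector_derivative[symmetric] intro: has_field_derivative_at_within)
    then show ?thesis by (rule integral_unique)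
  qed
  have G_eq: "G x = g x" if "x \<in> {0<..<x\<^sub>1}" for x
  proof (cases "c \<le> x")
    case True
    have "integral {0..x} D = integral {0..c} D + integral {c..x} D"
      using True that x1 integrable_on_subinterval[OF D_int, of 0 x]
      by (subst Henstock_Kurzweil_Integration.integral_combine) (auto simp: c_def)
    then show ?thesis using FTC[of c x] True that x1 by (simp add: G_def c_def)
  next
    case False
    have "integral {0..c} D = integral {0..x} D + integral {x..c} D"
      using False that x1 integrable_on_subinterval[OF D_int, of 0 c]
      by (subst Henstock_Kurzweil_Integration.integral_combine) (auto simp: c_def)
    then show ?thesis using FTC[of x c] False that x1 by (simp add: G_def c_def)
  qed
  have G_deriv: "(G has_real_derivative D x) (at x)" if "x \<in> {0<..<x\<^sub>1}" for x
    using deriv[OF that] by (rule has_field_derivative_transform_within_open[of _ _ _ "{0<..<x\<^sub>1}"])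
      (use that G_eq in auto)
  have G0: "G 0 \<ge> 0"
    using continuous_ge_on_Ioo[OF G_cont, of 0 0] nonneg G_eq x1 by auto
  \<comment> \<open>Truncation at zero puts the integrals for all \<open>x\<close> on the same
    interval, as dominated convergence requires.\<close>
  define \<phi> where "\<phi> x s = max 0 (x - s) powr \<beta>" for x s
  have parts: "((\<lambda>s. \<phi> x s * D s) has_integral \<beta> * R x - x powr \<beta> * G 0) {0..x\<^sub>1}"
    if x: "x \<in> {0<..x\<^sub>1}" for x
  proof -
    \<comment> \<open>The antiderivative vanishes at \<open>s = x\<close> because
      \<open>0 powr \<beta> = 0\<close>, so the only boundary term is the one with
      \<open>G 0\<close>.\<close>
    have "((\<lambda>s. \<beta> * ((x - s) powr (\<beta> - 1) * g s) - (x - s) powr \<beta> * D s) has_integral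
        - ((x - x) powr \<beta> * G x) - - ((x - 0) powr \<beta> * G 0)) {0..x}"
    proof (rule fundamental_theorem_of_calculus_interior)
      show "continuous_on {0..x} (\<lambda>s. - ((x - s) powr \<beta> * G s))"
        using x \<beta> by (intro continuous_intros continuous_on_powr' continuous_on_subset[OF G_cont]) auto
      show "((\<lambda>s. - ((x - s) powr \<beta> * G s)) has_vector_derivative
          \<beta> * ((x - s) powr (\<beta> - 1) * g s) - (x - s) powr \<beta> * D s) (at s)" if s: "s \<in> {0<..<x}" for s
        using x s G_eq[of s] unfolding has_real_derivative_iff_has_vector_derivative[symmetric]
        by (auto intro!: derivative_eq_intros G_deriv)
    qed (use x in auto)
    from has_integral_diff[OF has_integral_mult_right[OF R[OF x], of \<beta>] this]
    have "((\<lambda>s. (x - s) powr \<beta> * D s) has_integral \<beta> * R x - x powr \<beta> * G 0) {0..x}"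
      using x by simp
    then have "((\<lambda>s. \<phi> x s * D s) has_integral \<beta> * R x - x powr \<beta> * G 0) {0..x}"
      by (rule has_integral_eq[rotated]) (auto simp: \<phi>_def max_def)
    moreover have "((\<lambda>s. \<phi> x s * D s) has_integral 0) {x..x\<^sub>1}"
      by (rule has_integral_is_0) (auto simp: \<phi>_def max_def)
    ultimately have "((\<lambda>s. \<phi> x s * D s) has_integral (\<beta> * R x - x powr \<beta> * G 0) + 0) {0..x\<^sub>1}"
      using x by (intro has_integral_combine[of 0 x x\<^sub>1]) auto
    then show ?thesis by simp
  qed
  define P where "P x = \<beta> * R x - x powr \<beta> * G 0" for x
  define q where "q x s = (\<phi> x\<^sub>1 s - \<phi> x s) / (x\<^sub>1 - x)" for x s
  have q_int: "((\<lambda>s. q x s * D s) has_integral (P x\<^sub>1 - P x) / (x\<^sub>1 - x)) {0<..<x\<^sub>1}"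
    if "x \<in> {0<..<x\<^sub>1}" for x
  proof -
    have "((\<lambda>s. (\<phi> x\<^sub>1 s * D s - \<phi> x s * D s) / (x\<^sub>1 - x)) has_integral (P x\<^sub>1 - P x) / (x\<^sub>1 - x)) {0..x\<^sub>1}"
      using that x1 unfolding P_def by (intro has_integral_divide has_integral_diff parts) auto
    then show ?thesis
      by (simp add: q_def has_integral_Icc_iff_Ioo left_diff_distrib)
  qed
  \<comment> \<open>The quotients \<open>q x s\<close> are dominated by the kernel of
    \<open>E\<close>, so \<open>\<bar>E\<bar>\<close> is an integrable majorant; pointwise they tend
    to the derivative of \<open>\<phi>\<close> in its first argument.\<close>
  have "((\<lambda>x. (P x\<^sub>1 - P x) / (x\<^sub>1 - x)) \<longlongrightarrow> \<beta> * integral {0<..<x\<^sub>1} E) (at_left x\<^sub>1)"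
  proof (rule tendsto_at_left_sequentially[OF x1])
    fix S :: "nat \<Rightarrow> real"
    assume S: "\<And>n. S n < x\<^sub>1" "\<And>n. 0 < S n" "S \<longlonglongrightarrow> x\<^sub>1"
    have "(\<lambda>n. integral {0<..<x\<^sub>1} (\<lambda>s. q (S n) s * D s)) \<longlonglongrightarrow> integral {0<..<x\<^sub>1} (\<lambda>s. \<beta> * E s)"
    proof (rule dominated_convergence)
      show "(\<lambda>s. q (S n) s * D s) integrable_on {0<..<x\<^sub>1}" for n
        using q_int[of "S n"] S by auto
      show "(\<lambda>s. norm (E s)) integrable_on {0<..<x\<^sub>1}"
        using E by (simp add: absolutely_integrable_on_def)
      show "norm (q (S n) s * D s) \<le> norm (E s)" if "s \<in> {0<..<x\<^sub>1}" for n s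
      proof -
        have "\<bar>q (S n) s\<bar> \<le> (x\<^sub>1 - s) powr (\<beta> - 1)"
          using powr_diff_quotient_le[OF \<beta>, of "x\<^sub>1 - S n" "x\<^sub>1 - s"] S that
          by (simp add: q_def \<phi>_def)
        then show ?thesis
          by (simp add: E_def abs_mult mult_right_mono)
      qed
      show "(\<lambda>n. q (S n) s * D s) \<longlonglongrightarrow> \<beta> * E s" if s: "s \<in> {0<..<x\<^sub>1}" for s
      proof -
        have "((\<lambda>x. (x - s) powr \<beta>) has_real_derivative \<beta> * (x\<^sub>1 - s) powr (\<beta> - 1)) (at x\<^sub>1)"
          using s by (auto intro!: derivative_eq_intros)
        then have "((\<lambda>x. \<phi> x s) has_real_derivative \<beta> * (x\<^sub>1 - s) powr (\<beta> - 1)) (at x\<^sub>1)"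
          by (rule has_field_derivative_transform_within_open[of _ _ _ "{s<..}"])
            (use s in \<open>auto simp: \<phi>_def max_def\<close>)
        then have "((\<lambda>x. (\<phi> x s - \<phi> x\<^sub>1 s) / (x - x\<^sub>1)) \<longlongrightarrow> \<beta> * (x\<^sub>1 - s) powr (\<beta> - 1)) (at x\<^sub>1)"
          by (simp add: has_field_derivative_iff)
        moreover have "(\<phi> x s - \<phi> x\<^sub>1 s) / (x - x\<^sub>1) = q x s" for x
          unfolding q_def by (metis minus_diff_eq minus_divide_divide)
        ultimately have "((\<lambda>x. q x s) \<longlongrightarrow> \<beta> * (x\<^sub>1 - s) powr (\<beta> - 1)) (at x\<^sub>1)"
          by simp
        moreover have "filterlim S (at x\<^sub>1) sequentially"
          using S by (auto simp: filterlim_at less_imp_neq intro!: always_eventually)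
        ultimately have "(\<lambda>n. q (S n) s) \<longlonglongrightarrow> \<beta> * (x\<^sub>1 - s) powr (\<beta> - 1)"
          by (rule filterlim_compose)
        then show ?thesis
          unfolding E_def mult.assoc[symmetric] by (intro tendsto_intros)
      qed
    qed
    moreover have "integral {0<..<x\<^sub>1} (\<lambda>s. q (S n) s * D s) = (P x\<^sub>1 - P (S n)) / (x\<^sub>1 - S n)" for n
      using q_int[of "S n"] S by (auto dest: integral_unique)
    ultimately show "(\<lambda>n. (P x\<^sub>1 - P (S n)) / (x\<^sub>1 - S n)) \<longlonglongrightarrow> \<beta> * integral {0<..<x\<^sub>1} E"
      by simp
  qed
  moreover define I where "I = integral {0<..<x\<^sub>1} E"
  moreover have "\<beta> * I / 2 < \<beta> * I"
    using pos \<beta> by (simp add: I_def)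
  ultimately have "\<forall>\<^sub>F x in at_left x\<^sub>1. \<beta> * I / 2 < (P x\<^sub>1 - P x) / (x\<^sub>1 - x)"
    by (metis order_tendstoD(1))
  moreover have "\<forall>\<^sub>F x in at_left x\<^sub>1. x \<in> {0<..<x\<^sub>1}"
    using x1 by (rule eventually_at_left_real)
  ultimately have "\<forall>\<^sub>F x in at_left x\<^sub>1. R x \<le> R x\<^sub>1 - I / 2 * (x\<^sub>1 - x)"
  proof eventually_elim
    case (elim x)
    then have "\<beta> * I / 2 * (x\<^sub>1 - x) \<le> P x\<^sub>1 - P x"
      by (simp add: pos_less_divide_eq)
    \<comment> \<open>Here \<open>G 0 \<ge> 0\<close> enters: the boundary term is nondecreasing in
      \<open>x\<close>, so the growth of \<open>P\<close> is inherited by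
      \<open>\<beta> * R\<close>.\<close>
    moreover have "x powr \<beta> * G 0 \<le> x\<^sub>1 powr \<beta> * G 0"
      using elim \<beta> G0 by (intro mult_right_mono powr_mono2) auto
    ultimately have "\<beta> * (I / 2 * (x\<^sub>1 - x)) \<le> \<beta> * (R x\<^sub>1 - R x)"
      by (simp add: P_def algebra_simps)
    then have "I / 2 * (x\<^sub>1 - x) \<le> R x\<^sub>1 - R x"
      using \<beta> by simp
    then show ?case by simp
  qed
  then show ?thesis
    using pos by (intro exI[of _ "I / 2"]) (simp add: I_def)
qed

section \<open>Integrability of weakly singular kernels, and Borel versus Lebesgue integrals\<close>

text \<open>The Beta kernel with exponents \<open>p\<close> and \<open>1 - a\<close>, scaled by
  \<open>K\<close>, is an integrable majorant.\<close>

lemma frac_kernel_integrable: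
  fixes a p x K :: real and f :: "real \<Rightarrow> real"
  assumes "a < 1" "p > 0" "x > 0"
    and f: "f \<in> borel_measurable borel"
    and bound: "\<And>s. s \<in> {0<..<x} \<Longrightarrow> \<bar>f s\<bar> \<le> K * s powr - a"
  shows "(\<lambda>s. (x - s) powr (p - 1) * f s) integrable_on {0..x}"
proof -
  let ?h = "\<lambda>s. K * ((x - s) powr (p - 1) * (s - 0) powr ((1 - a) - 1))"
  have "(\<lambda>s. (x - s) powr (p - 1) * f s) absolutely_integrable_on {0<..<x}"
  proof (rule measurable_bounded_by_integrable_imp_absolutely_integrable)
    show "(\<lambda>s. (x - s) powr (p - 1) * f s) \<in> borel_measurable (lebesgue_on {0<..<x})"
      using f by (intro measurable_restrict_space1 measurable_completion) simp
    have "?h integrable_on {0..x}"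
      using has_integral_beta_kernel[of p "1 - a" 0 x] assms
      by (intro integrable_on_mult_right) (auto simp: integrable_on_def)
    then show "?h integrable_on {0<..<x}"
      by (simp add: integrable_on_Icc_iff_Ioo)
    show "norm ((x - s) powr (p - 1) * f s) \<le> ?h s" if "s \<in> {0<..<x}" for s
    proof -
      have "(x - s) powr (p - 1) * \<bar>f s\<bar> \<le> (x - s) powr (p - 1) * (K * s powr - a)"
        using bound[OF that] by (intro mult_left_mono) auto
      then show ?thesis by (simp add: abs_mult mult_ac)
    qed
  qed simp
  then have "(\<lambda>s. (x - s) powr (p - 1) * f s) integrable_on {0<..<x}"
    by (rule set_lebesgue_integral_eq_integral)
  then show ?thesis by (simp add: integrable_on_Icc_iff_Ioo)
qed

lemma set_lborel_lebesgue:
  fixes H :: "real \<Rightarrow> real"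
  assumes "set_integrable lborel S H"
  shows "H absolutely_integrable_on S" "(LBINT s:S. H s) = integral S H"
proof -
  show "H absolutely_integrable_on S"
    using assms unfolding set_integrable_def by (auto simp: integrable_completion dest: borel_measurable_integrable)
  show "(LBINT s:S. H s) = integral S H"
    by (rule set_borel_integral_eq_integral[OF assms])
qed

text \<open>Integrability for the completed measure does not give Borel measurability; continuity on
  a Borel set does. It connects the integrals in the definitions with the gauge integral.\<close>

lemma set_lebesgue_imp_lborel:
  fixes H :: "real \<Rightarrow> real"
  assumes "H absolutely_integrable_on S" "continuous_on S H" "S \<in> sets borel"
  shows "set_integrable lborel S H"
proof -
  have "(\<lambda>s. indicator S s *\<^sub>R H s) \<in> borel_measurable lborel"
    using borel_measurable_continuous_on_indicator[OF assms(3,2)] by simp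
  then show ?thesis
    using assms(1) unfolding set_integrable_def by (simp add: integrable_completion)
qed

section \<open>The change of time by \<Psi> and its inverse\<close>

locale time_change =
  fixes T :: real and \<Psi> \<psi> :: "real \<Rightarrow> real"
  assumes T_pos: "T > 0"
    and mono: "mono_on {0..T} \<Psi>"
    and deriv: "\<And>t. t \<in> {0..T} \<Longrightarrow> (\<Psi> has_real_derivative \<psi> t) (at t within {0..T})"
    and \<psi>_cont: "continuous_on {0..T} \<psi>"
    and \<psi>_nz: "\<And>t. t \<in> {0..T} \<Longrightarrow> \<psi> t \<noteq> 0"
begin

text \<open>Difference quotients of a monotone function are nonnegative, hence so is their limit; it
  is nonzero by assumption.\<close>

lemma \<psi>_pos: "\<psi> t > 0" if t: "t \<in> {0..T}"
proof -
  have "((\<lambda>s. (\<Psi> s - \<Psi> t) / (s - t)) \<longlongrightarrow> \<psi> t) (at t within {0..T})"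
    using deriv[OF t] by (simp add: has_field_derivative_iff)
  moreover have "\<forall>\<^sub>F s in at t within {0..T}. 0 \<le> (\<Psi> s - \<Psi> t) / (s - t)"
    unfolding eventually_at_filter
  proof (intro always_eventually allI impI)
    fix s assume "s \<noteq> t" "s \<in> {0..T}"
    then show "0 \<le> (\<Psi> s - \<Psi> t) / (s - t)"
      using mono_onD[OF mono, of s t] mono_onD[OF mono, of t s] t
      by (cases "s \<le> t") (auto simp: divide_nonpos_nonpos)
  qed
  moreover have "at t within {0..T} \<noteq> bot"
    using t T_pos trivial_limit_within[of t "{0..T}"] islimpt_Icc[of 0 T t] by simp
  ultimately have "0 \<le> \<psi> t"
    by (rule tendsto_lowerbound)
  with \<psi>_nz[OF t] show ?thesis by simp
qed

definition Y :: "real \<Rightarrow> real" where "Y t = \<Psi> t - \<Psi> 0"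

lemma Y_deriv: "t \<in> {0..T} \<Longrightarrow> (Y has_real_derivative \<psi> t) (at t within {0..T})"
  unfolding Y_def using deriv by (auto intro!: derivative_eq_intros)

lemma Y_cont: "continuous_on {0..T} Y"
  using Y_deriv by (rule DERIV_continuous_on)

lemma Y_0 [simp]: "Y 0 = 0" by (simp add: Y_def)

lemma Y_less: "Y s < Y t" if "0 \<le> s" "s < t" "t \<le> T"
proof (rule DERIV_pos_imp_increasing_open[OF \<open>s < t\<close>])
  show "\<exists>y. (Y has_real_derivative y) (at x) \<and> 0 < y" if "s < x" "x < t" for x
    using Y_deriv[of x] \<psi>_pos[of x] that \<open>0 \<le> s\<close> \<open>t \<le> T\<close> by (auto simp: at_within_Icc_at)
  show "continuous_on {s..t} Y"
    using that by (intro continuous_on_subset[OF Y_cont]) auto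
qed

lemma Y_inj: "inj_on Y {0..T}"
  by (rule linorder_inj_onI) (use Y_less in \<open>fastforce+\<close>)

definition \<Phi> :: "real \<Rightarrow> real" where "\<Phi> = the_inv_into {0..T} Y"

lemma \<Phi>_Y [simp]: "t \<in> {0..T} \<Longrightarrow> \<Phi> (Y t) = t"
  unfolding \<Phi>_def using Y_inj by (rule the_inv_into_f_f)

lemma Y_image_Icc: "Y ` {0..t} = {0..Y t}" if "t \<in> {0..T}"
proof
  show "Y ` {0..t} \<subseteq> {0..Y t}"
    using Y_less[of 0] Y_less[of _ t] that by (force simp: le_less)
  show "{0..Y t} \<subseteq> Y ` {0..t}"
  proof
    fix y assume "y \<in> {0..Y t}"
    then show "y \<in> Y ` {0..t}"
      using IVT'[of Y 0 y t] continuous_on_subset[OF Y_cont, of "{0..t}"] that by auto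
  qed
qed

lemma Y_image_Ioo: "Y ` {0<..<t} = {0<..<Y t}" if "t \<in> {0..T}"
proof -
  have "{0<..<t} = {0..t} - {0, t}" "{0<..<Y t} = {0..Y t} - {0, Y t}" by auto
  moreover have "Y ` ({0..t} - {0, t}) = Y ` {0..t} - Y ` {0, t}"
    using that by (intro inj_on_image_set_diff[OF Y_inj]) auto
  ultimately show ?thesis using Y_image_Icc[OF that] by simp
qed

lemma \<Phi>_mem: "\<Phi> y \<in> {0<..<t}" if t: "t \<in> {0..T}" and y: "y \<in> {0<..<Y t}"
proof -
  obtain s where "s \<in> {0<..<t}" "y = Y s"
    using y unfolding Y_image_Ioo[OF t, symmetric] by blast
  with t show ?thesis by auto
qed

lemma Y_\<Phi>: "Y (\<Phi> y) = y" if y: "y \<in> {0..Y T}"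
proof -
  have "{0..Y T} = Y ` {0..T}" using Y_image_Icc[of T] T_pos by simp
  then obtain s where "s \<in> {0..T}" "y = Y s" using y by blast
  then show ?thesis by simp
qed

lemma \<Phi>_cont: "continuous_on {0..Y T} \<Phi>"
  using continuous_on_inv[OF Y_cont compact_Icc, of \<Phi>] Y_image_Icc[of T] T_pos by simp

lemma \<Phi>_deriv: "(\<Phi> has_real_derivative inverse (\<psi> (\<Phi> y))) (at y)" if y: "y \<in> {0<..<Y T}"
proof (rule has_field_derivative_inverse_basic[of Y])
  have "\<Phi> y \<in> {0<..<T}" using \<Phi>_mem[OF _ y] T_pos by simp
  then show "DERIV Y (\<Phi> y) :> \<psi> (\<Phi> y)" "\<psi> (\<Phi> y) \<noteq> 0"
    using Y_deriv[of "\<Phi> y"] \<psi>_nz[of "\<Phi> y"] by (auto simp: at_within_Icc_at)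
  show "continuous (at y) \<Phi>"
    using continuous_on_interior[OF \<Phi>_cont] y by simp
  show "open {0<..<Y T}" "y \<in> {0<..<Y T}" using y by auto
  show "Y (\<Phi> z) = z" if "z \<in> {0<..<Y T}" for z using Y_\<Phi> that by auto
qed

lemma filterlim_\<Phi>_at_left: "filterlim \<Phi> (at_left t) (at_left (Y t))" if t: "t \<in> {0<..T}"
proof -
  have Yt: "0 < Y t" using Y_less[of 0 t] t by simp
  have "continuous_on {0..Y t} \<Phi>"
    using Y_less[of t T] t by (intro continuous_on_subset[OF \<Phi>_cont]) (cases "t = T"; force)
  then have "(\<Phi> \<longlongrightarrow> \<Phi> (Y t)) (at (Y t) within {0..Y t})"
    using Yt by (simp add: continuous_on)
  then have "(\<Phi> \<longlongrightarrow> t) (at_left (Y t))"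
    using t Yt by (simp add: at_within_Icc_at_left)
  moreover have "\<forall>\<^sub>F y in at_left (Y t). y \<in> {0<..<Y t}"
    using Yt by (rule eventually_at_left_real)
  then have "\<forall>\<^sub>F y in at_left (Y t). \<Phi> y \<in> {..<t} \<and> \<Phi> y \<noteq> t"
    by eventually_elim (use \<Phi>_mem[of t] t in force)
  ultimately show ?thesis by (simp add: filterlim_at)
qed

text \<open>Change of variables \<open>y = Y s\<close>, with the absolute value of the derivative
  dropped as it is positive. Integrability is needed in both directions: from new to old time for
  the inner integral, from old to new for the outer one.\<close>

lemma substitution:
  fixes F H :: "real \<Rightarrow> real"
  assumes t: "t \<in> {0..T}"
    and H: "\<And>s. s \<in> {0<..<t} \<Longrightarrow> H s = \<psi> s * F (Y s)"
  shows "H absolutely_integrable_on {0<..<t} \<longleftrightarrow> F absolutely_integrable_on {0<..<Y t}"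
    and "H absolutely_integrable_on {0<..<t} \<Longrightarrow> integral {0<..<t} H = integral {0<..<Y t} F"
proof -
  have H': "\<bar>\<psi> s\<bar> * F (Y s) = H s" if "s \<in> {0<..<t}" for s
    using H[OF that] \<psi>_pos[of s] that t by auto
  have *: "H absolutely_integrable_on {0<..<t} \<and> integral {0<..<t} H = b \<longleftrightarrow>
      F absolutely_integrable_on {0<..<Y t} \<and> integral {0<..<Y t} F = b" for b
  proof -
    have "(\<lambda>s. \<bar>\<psi> s\<bar> * F (Y s)) absolutely_integrable_on {0<..<t} \<and>
        integral {0<..<t} (\<lambda>s. \<bar>\<psi> s\<bar> * F (Y s)) = b \<longleftrightarrow>
      F absolutely_integrable_on (Y ` {0<..<t}) \<and> integral (Y ` {0<..<t}) F = b"
    proof (rule has_absolute_integral_change_of_variables_1')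
      show "(Y has_field_derivative \<psi> s) (at s within {0<..<t})" if "s \<in> {0<..<t}" for s
        using that t by (intro has_field_derivative_subset[OF Y_deriv]) auto
      show "inj_on Y {0<..<t}" using t by (intro inj_on_subset[OF Y_inj]) auto
    qed simp
    moreover have "(\<lambda>s. \<bar>\<psi> s\<bar> * F (Y s)) absolutely_integrable_on {0<..<t} \<longleftrightarrow> H absolutely_integrable_on {0<..<t}"
      by (rule set_integrable_cong) (use H' in auto)
    moreover have "integral {0<..<t} (\<lambda>s. \<bar>\<psi> s\<bar> * F (Y s)) = integral {0<..<t} H"
      by (rule integral_cong) (rule H')
    ultimately show ?thesis by (simp add: Y_image_Ioo[OF t])
  qed
  show "H absolutely_integrable_on {0<..<t} \<longleftrightarrow> F absolutely_integrable_on {0<..<Y t}"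
    and "H absolutely_integrable_on {0<..<t} \<Longrightarrow> integral {0<..<t} H = integral {0<..<Y t} F"
    using * by blast+
qed

text \<open>By the chain rule, division by \<psi> turns the derivative in \<open>t\<close> into the
  ordinary derivative in the new time.\<close>

lemma psi_deriv_pullback:
  assumes y: "y \<in> {0<..<Y T}" and g: "g differentiable (at (\<Phi> y) within {0..T})"
  shows "((\<lambda>x. g (\<Phi> x)) has_real_derivative psi_deriv T \<psi> g (\<Phi> y)) (at y)"
proof -
  have \<Phi>y: "\<Phi> y \<in> {0<..<T}" using \<Phi>_mem[OF _ y] T_pos by simp
  have "(g has_real_derivative vector_derivative g (at (\<Phi> y) within {0..T})) (at (\<Phi> y))"
    using g \<Phi>y unfolding has_real_derivative_iff_has_vector_derivative
    by (simp add: vector_derivative_works at_within_Icc_at)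
  from DERIV_chain2[OF this \<Phi>_deriv[OF y]] show ?thesis
    by (simp add: psi_deriv_def field_simps)
qed

text \<open>The quotient of the left difference quotients of \<open>g\<close> and \<open>Y\<close>
  tends to the \<Psi>-derivative; half of the limit is a valid slope. This serves outer order zero,
  where differentiability is given only at the point itself. Left limits cover \<open>t = T\<close>
  as well.\<close>

lemma psi_deriv_pos_imp_left_growth:
  assumes t: "t \<in> {0<..T}" and g: "g differentiable (at t within {0..T})"
    and pos: "psi_deriv T \<psi> g t > 0"
  shows "\<exists>L>0. \<forall>\<^sub>F x in at_left (Y t). g (\<Phi> x) \<le> g t - L * (Y t - x)"
proof -
  have lim: "((\<lambda>s. (h s - h t) / (s - t)) \<longlongrightarrow> h') (at_left t)"
    if "(h has_real_derivative h') (at t within {0..T})" for h h'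
    using has_field_derivative_subset[OF that, of "{0..t}"] t
    by (simp add: has_field_derivative_iff at_within_Icc_at_left)
  define L where "L = psi_deriv T \<psi> g t"
  have \<psi>t: "\<psi> t > 0" using \<psi>_pos t by simp
  have "(g has_real_derivative vector_derivative g (at t within {0..T})) (at t within {0..T})"
    using g unfolding has_real_derivative_iff_has_vector_derivative by (simp add: vector_derivative_works)
  from tendsto_divide[OF lim[OF this] lim[OF Y_deriv]]
  have "((\<lambda>s. ((g s - g t) / (s - t)) / ((Y s - Y t) / (s - t))) \<longlongrightarrow> L) (at_left t)"
    using t \<psi>t by (simp add: L_def psi_deriv_def)
  then have "\<forall>\<^sub>F s in at_left t. L / 2 < ((g s - g t) / (s - t)) / ((Y s - Y t) / (s - t))"
    using pos by (intro order_tendstoD(1)) (auto simp: L_def)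
  moreover have "\<forall>\<^sub>F s in at_left t. s \<in> {0<..<t}"
    using t by (intro eventually_at_left_real) simp
  ultimately have "\<forall>\<^sub>F s in at_left t. g s \<le> g t - L / 2 * (Y t - Y s)"
  proof eventually_elim
    case (elim s)
    then have "Y s < Y t" using Y_less t by auto
    moreover have "((g s - g t) / (s - t)) / ((Y s - Y t) / (s - t)) = (g t - g s) / (Y t - Y s)"
      using elim \<open>Y s < Y t\<close> by (simp add: divide_simps) (simp add: algebra_simps)
    ultimately have "L / 2 * (Y t - Y s) < g t - g s"
      using elim by (simp add: pos_less_divide_eq)
    then show ?case by simp
  qed
  then have "\<forall>\<^sub>F x in at_left (Y t). g (\<Phi> x) \<le> g t - L / 2 * (Y t - Y (\<Phi> x))"
    using filterlim_\<Phi>_at_left[OF t] by (rule eventually_compose_filterlim)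
  moreover have "\<forall>\<^sub>F x in at_left (Y t). x \<in> {0<..<Y t}"
    using t Y_less[of 0 t] by (intro eventually_at_left_real) simp
  ultimately have "\<forall>\<^sub>F x in at_left (Y t). g (\<Phi> x) \<le> g t - L / 2 * (Y t - x)"
  proof eventually_elim
    case (elim x)
    have "Y t \<le> Y T" using Y_less[of t T] t by (cases "t = T") auto
    then have "Y (\<Phi> x) = x" using elim by (intro Y_\<Phi>) auto
    then show ?case using elim by simp
  qed
  then show ?thesis using pos by (intro exI[of _ "L / 2"]) (simp add: L_def)
qed

end

section \<open>Transfer to the new time and contradiction, for outer order zero and positive\<close>

theorem theorem4p2:
  fixes T \<mu> \<nu> \<xi> t\<^sub>1 :: real and \<Psi> \<psi> m :: "real \<Rightarrow> real"
  assumes "T > 0"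
    and "0 < \<mu>" and "\<mu> < 1" and "0 \<le> \<nu>" and "\<nu> \<le> 1"
    and "\<xi> = \<mu> + \<nu> * (1 - \<mu>)"
    and "mono_on {0..T} \<Psi>"
    and "\<And>t. t \<in> {0..T} \<Longrightarrow> (\<Psi> has_real_derivative \<psi> t) (at t within {0..T})"
    and "continuous_on {0..T} \<psi>"
    and "\<And>t. t \<in> {0..T} \<Longrightarrow> \<psi> t \<noteq> 0"
    and "m \<in> weighted_continuous T \<Psi> (1 - \<xi>)"
    and "t\<^sub>1 \<in> {0<..T}"
    and "m t\<^sub>1 = 0"
    and "\<And>t. t \<in> {0<..<t\<^sub>1} \<Longrightarrow> m t \<ge> 0"
    and "psi_hilfer_deriv_exists T \<Psi> \<psi> \<mu> \<nu> m t\<^sub>1"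
  shows "psi_hilfer_deriv T \<Psi> \<psi> \<mu> \<nu> m t\<^sub>1 \<le> 0"
proof (rule ccontr)
  assume "\<not> psi_hilfer_deriv T \<Psi> \<psi> \<mu> \<nu> m t\<^sub>1 \<le> 0"
  interpret time_change T \<Psi> \<psi>
    using assms by unfold_locales auto
  note \<mu> = \<open>0 < \<mu>\<close> \<open>\<mu> < 1\<close> and t1 = \<open>t\<^sub>1 \<in> {0<..T}\<close>
  define a where "a = (1 - \<nu>) * (1 - \<mu>)"
  define \<beta> where "\<beta> = \<nu> * (1 - \<mu>)"
  \<comment> \<open>The weight exponent equals the inner order \<open>a\<close>, so in the new time
    \<open>m\<close> is at most of size \<open>y powr - a\<close> near zero, with
    \<open>a < 1\<close>.\<close>
  have ab: "a + \<beta> = 1 - \<mu>" and a_weight: "1 - \<xi> = a"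
    using assms(6) by (simp_all add: a_def \<beta>_def algebra_simps)
  have a: "0 \<le> a" "a < 1" and \<beta>: "0 \<le> \<beta>" "\<beta> < 1"
    using assms(2-5) ab by (auto simp: a_def \<beta>_def intro: le_less_trans[of _ "1 - \<mu>"])
  define x\<^sub>1 where "x\<^sub>1 = Y t\<^sub>1"
  have x1: "0 < x\<^sub>1" "x\<^sub>1 \<le> Y T"
    using Y_less[of 0 t\<^sub>1] Y_less[of t\<^sub>1 T] t1 by (auto simp: x\<^sub>1_def) (cases "t\<^sub>1 = T"; auto)
  obtain w where w: "continuous_on {0..T} w"
    and w_eq: "\<And>t. t \<in> {0<..T} \<Longrightarrow> w t = Y t powr a * m t"
    using assms(11) unfolding weighted_continuous_def a_weight Y_def by auto
  have m_eq: "m t = Y t powr - a * w t" if "t \<in> {0<..T}" for t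
    using w_eq[OF that] Y_less[of 0 t] that by (simp add: powr_minus field_simps)
  have "bounded (w ` {0..T})"
    using compact_imp_bounded[OF compact_continuous_image[OF w compact_Icc]] .
  then obtain K where "\<forall>z\<in>w ` {0..T}. norm z \<le> K"
    unfolding bounded_iff by blast
  then have K: "\<bar>w t\<bar> \<le> K" if "t \<in> {0..T}" for t
    using that by simp
  \<comment> \<open>\<open>m\<close> in the new time, cut off outside \<open>(0, x\<^sub>1]\<close>
    to be Borel and nonnegative on the whole line.\<close>
  define f where "f y = indicator {0<..x\<^sub>1} y *\<^sub>R (y powr - a * w (\<Phi> y))" for y
  have \<Phi>_ex: "\<exists>s\<in>{0<..t\<^sub>1}. y = Y s" if "y \<in> {0<..x\<^sub>1}" for y
  proof (cases "y = x\<^sub>1")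
    case False
    then have "y \<in> Y ` {0<..<t\<^sub>1}" using that t1 by (subst Y_image_Ioo) (auto simp: x\<^sub>1_def)
    then show ?thesis by auto
  qed (use t1 in \<open>auto simp: x\<^sub>1_def\<close>)
  have Y_mem: "Y s \<in> {0<..x\<^sub>1}" if "s \<in> {0<..t\<^sub>1}" for s
    using Y_less[of 0 s] Y_less[of s t\<^sub>1] that t1 unfolding x\<^sub>1_def by (cases "s = t\<^sub>1") auto
  have fY: "f (Y s) = m s" if "s \<in> {0<..t\<^sub>1}" for s
    using Y_mem[OF that] m_eq[of s] that t1 by (simp add: f_def)
  have f0: "f y = 0" if "y \<notin> {0<..x\<^sub>1}" for y using that by (simp add: f_def)
  have f_nonneg: "f y \<ge> 0" for y
  proof (cases "y \<in> {0<..x\<^sub>1}")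
    case True
    then obtain s where s: "s \<in> {0<..t\<^sub>1}" "y = Y s" using \<Phi>_ex by blast
    then show ?thesis using fY[OF s(1)] assms(13) assms(14)[of s] by (cases "s = t\<^sub>1") auto
  qed (simp add: f0)
  have body_cont: "continuous_on {0<..x\<^sub>1} (\<lambda>y. y powr - a * w (\<Phi> y))"
  proof (intro continuous_intros continuous_on_compose2[OF w])
    show "continuous_on {0<..x\<^sub>1} \<Phi>" using x1 by (intro continuous_on_subset[OF \<Phi>_cont]) auto
    show "\<Phi> ` {0<..x\<^sub>1} \<subseteq> {0..T}" using \<Phi>_ex t1 by force
  qed auto
  have f_borel: "f \<in> borel_measurable borel"
    unfolding f_def using body_cont by (intro borel_measurable_continuous_on_indicator) auto
  have f_bound: "\<bar>f s\<bar> \<le> K * s powr - a" if "x \<le> x\<^sub>1" "s \<in> {0<..<x}" for x s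
  proof -
    have "\<Phi> s \<in> {0..T}" using \<Phi>_ex[of s] that t1 by force
    then have "s powr - a * \<bar>w (\<Phi> s)\<bar> \<le> s powr - a * K" using K by (intro mult_left_mono) auto
    then show ?thesis using that by (simp add: f_def abs_mult mult.commute)
  qed
  \<comment> \<open>The weight is harmless away from zero, so weighted continuity turns
    \<open>m t\<^sub>1 = 0\<close> into a left limit.\<close>
  have f_lim: "(f \<longlongrightarrow> 0) (at_left x\<^sub>1)"
  proof -
    have "continuous_on {0<..x\<^sub>1} f"
      using body_cont by (rule continuous_on_eq) (simp add: f_def)
    then have "continuous_on {x\<^sub>1 / 2..x\<^sub>1} f"
      by (rule continuous_on_subset) (use x1 in auto)
    then have "(f \<longlongrightarrow> f x\<^sub>1) (at x\<^sub>1 within {x\<^sub>1 / 2..x\<^sub>1})"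
      using x1 by (simp add: continuous_on)
    moreover have "f x\<^sub>1 = 0"
      using fY[of t\<^sub>1] assms(13) t1 by (simp add: x\<^sub>1_def)
    ultimately show ?thesis using x1 by (simp add: at_within_Icc_at_left)
  qed
  have kernel_int: "(\<lambda>s. (x - s) powr (p - 1) * f s) integrable_on {0..x}"
    if "p > 0" "x \<in> {0<..x\<^sub>1}" for p x
    using a that by (intro frac_kernel_integrable[OF _ _ _ f_borel f_bound]) auto
  define R where "R x = integral {0..x} (\<lambda>s. (x - s) powr - \<mu> * f s)" for x
  have R: "((\<lambda>s. (x - s) powr - \<mu> * f s) has_integral R x) {0..x}" if "x \<in> {0<..x\<^sub>1}" for x
    using kernel_int[of "1 - \<mu>" x] that \<mu> unfolding R_def by (simp add: has_integral_integral)
  define S where "S x = integral {0..x} (\<lambda>s. (x - s) powr (a - 1) * f s)" for x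
  define g where "g = psi_frac_int \<Psi> \<psi> a m"
  have g_Y: "g t = S (Y t) / Gamma a" if t: "t \<in> {0<..t\<^sub>1}" and "a > 0" for t
  proof -
    define F where "F y = (Y t - y) powr (a - 1) * f y" for y
    define H where "H = psi_frac_integrand \<Psi> \<psi> a m t"
    have H: "H s = \<psi> s * F (Y s)" if "s \<in> {0<..<t}" for s
      using fY[of s] that t by (simp add: H_def F_def psi_frac_integrand_def Y_def)
    have "F integrable_on {0..Y t}"
      unfolding F_def using kernel_int[OF \<open>a > 0\<close> Y_mem[OF t]] .
    then have "F absolutely_integrable_on {0<..<Y t}"
      using f_nonneg by (intro nonnegative_absolutely_integrable_1)
        (auto simp: F_def integrable_on_Icc_iff_Ioo[symmetric])
    then have H_abs: "H absolutely_integrable_on {0<..<t}"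
      using substitution(1)[of t H F] H t t1 by auto
    \<comment> \<open>Continuity of the integrand, with \<open>m\<close> replaced by its weighted
      form, supplies the Borel measurability for the integral in
      \<open>psi_frac_int\<close>.\<close>
    have "continuous_on {0<..<t} (\<lambda>s. \<psi> s * (Y t - Y s) powr (a - 1) * (Y s powr - a * w s))"
    proof (intro continuous_intros)
      show "\<forall>s\<in>{0<..<t}. Y t - Y s \<noteq> 0"
      proof
        fix s assume "s \<in> {0<..<t}"
        then have "Y s < Y t" using t t1 by (intro Y_less) auto
        then show "Y t - Y s \<noteq> 0" by simp
      qed
      show "\<forall>s\<in>{0<..<t}. Y s \<noteq> 0"
      proof
        fix s assume "s \<in> {0<..<t}"
        then have "Y 0 < Y s" using t t1 by (intro Y_less) auto
        then show "Y s \<noteq> 0" by simp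
      qed
      have sub: "{0<..<t} \<subseteq> {0..T}" using t t1 by auto
      show "continuous_on {0<..<t} \<psi>" by (rule continuous_on_subset[OF \<psi>_cont sub])
      show "continuous_on {0<..<t} Y" by (rule continuous_on_subset[OF Y_cont sub])
      show "continuous_on {0<..<t} Y" by (rule continuous_on_subset[OF Y_cont sub])
      show "continuous_on {0<..<t} w" by (rule continuous_on_subset[OF w sub])
    qed
    then have "continuous_on {0<..<t} H"
      by (rule continuous_on_eq)
        (use t t1 m_eq in \<open>auto simp: H_def psi_frac_integrand_def Y_def\<close>)
    then have "(LBINT s:{0<..<t}. H s) = integral {0<..<t} H"
      by (intro set_lborel_lebesgue(2) set_lebesgue_imp_lborel[OF H_abs]) auto
    also have "\<dots> = integral {0<..<Y t} F"
      using substitution(2)[of t H F] H H_abs t t1 by auto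
    also have "\<dots> = S (Y t)"
      by (simp add: S_def F_def[abs_def] integral_open_interval_real)
    finally show ?thesis
      using \<open>a > 0\<close> by (simp add: g_def psi_frac_int_def H_def)
  qed
  have g_\<Phi>: "g (\<Phi> y) = (if a = 0 then f y else S y / Gamma a)" if "y \<in> {0<..x\<^sub>1}" for y
  proof -
    obtain s where s: "s \<in> {0<..t\<^sub>1}" "y = Y s" using \<Phi>_ex \<open>y \<in> {0<..x\<^sub>1}\<close> by blast
    then have "\<Phi> y = s" using t1 by simp
    then show ?thesis
      using s a(1) g_Y[OF s(1)] fY[OF s(1)] by (auto simp: g_def psi_frac_int_def)
  qed
  have S_nonneg: "S y \<ge> 0" if "y \<in> {0<..x\<^sub>1}" "a > 0" for y
    unfolding S_def using kernel_int[OF that(2,1)] f_nonneg by (intro integral_nonneg) auto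
  have hilfer: "psi_frac_int \<Psi> \<psi> \<beta> (psi_deriv T \<psi> g) t\<^sub>1 > 0"
    using \<open>\<not> _ \<le> 0\<close> by (simp add: psi_hilfer_deriv_def g_def a_def \<beta>_def)
  have "\<exists>L>0. \<forall>\<^sub>F x in at_left x\<^sub>1. R x \<le> R x\<^sub>1 - L * (x\<^sub>1 - x)"
  proof (cases "\<beta> = 0")
    case True
    \<comment> \<open>Now \<open>a - 1 = - \<mu>\<close>, so \<open>g\<close> is \<open>R\<close>
      divided by \<open>Gamma a\<close> and the growth of \<open>g\<close> is that of
      \<open>R\<close>.\<close>
    with ab \<mu> have a_pos: "a > 0" and RS: "S = R" by (auto simp: R_def S_def fun_eq_iff)
    have "g differentiable (at t\<^sub>1 within {0..T})"
      using assms(15) True by (simp add: psi_hilfer_deriv_exists_def g_def a_def \<beta>_def Let_def)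
    moreover have "psi_deriv T \<psi> g t\<^sub>1 > 0"
      using hilfer True by (simp add: psi_frac_int_def)
    ultimately obtain L where L: "L > 0" "\<forall>\<^sub>F x in at_left x\<^sub>1. g (\<Phi> x) \<le> g t\<^sub>1 - L * (x\<^sub>1 - x)"
      using psi_deriv_pos_imp_left_growth[OF t1] unfolding x\<^sub>1_def by blast
    have \<Gamma>: "Gamma a > 0" using a_pos by (rule Gamma_real_pos)
    have "\<forall>\<^sub>F x in at_left x\<^sub>1. x \<in> {0<..<x\<^sub>1}"
      using x1(1) by (rule eventually_at_left_real)
    with L(2) have "\<forall>\<^sub>F x in at_left x\<^sub>1. R x \<le> R x\<^sub>1 - (L * Gamma a) * (x\<^sub>1 - x)"
    proof eventually_elim
      case (elim x)
      have "R x / Gamma a \<le> R x\<^sub>1 / Gamma a - L * (x\<^sub>1 - x)"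
        using elim g_\<Phi>[of x] g_Y[of t\<^sub>1] t1 a_pos by (simp add: RS x\<^sub>1_def)
      then show ?case using \<Gamma> by (simp add: field_simps)
    qed
    then show ?thesis using L(1) \<Gamma> by (intro exI[of _ "L * Gamma a"]) auto
  next
    case False
    with \<beta> have \<beta>_pos: "\<beta> > 0" by simp
    define D where "D y = psi_deriv T \<psi> g (\<Phi> y)" for y
    define H where "H = psi_frac_integrand \<Psi> \<psi> \<beta> (psi_deriv T \<psi> g) t\<^sub>1"
    have diff: "g differentiable (at s within {0..T})" if "s \<in> {0<..<t\<^sub>1}" for s
      using assms(15) False that
      by (simp add: psi_hilfer_deriv_exists_def g_def a_def \<beta>_def Let_def)
    have H_int: "set_integrable lborel {0<..<t\<^sub>1} H"
      using assms(15) False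
      by (simp add: psi_hilfer_deriv_exists_def g_def a_def \<beta>_def Let_def H_def)
    define E where "E s = (x\<^sub>1 - s) powr (\<beta> - 1) * D s" for s
    have HE: "H s = \<psi> s * E (Y s)" if "s \<in> {0<..<t\<^sub>1}" for s
      using that t1 by (simp add: H_def E_def D_def x\<^sub>1_def psi_frac_integrand_def Y_def[of t\<^sub>1] Y_def[of s] \<Phi>_Y[unfolded Y_def])
    have E_int: "E absolutely_integrable_on {0<..<x\<^sub>1}"
      using substitution(1)[of t\<^sub>1 H E] HE set_lborel_lebesgue(1)[OF H_int] t1 by (simp add: x\<^sub>1_def)
    have "(LBINT s:{0<..<t\<^sub>1}. H s) = integral {0<..<x\<^sub>1} E"
      using substitution(2)[of t\<^sub>1 H E] HE set_lborel_lebesgue[OF H_int] t1 by (simp add: x\<^sub>1_def)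
    then have E_pos: "integral {0<..<x\<^sub>1} E > 0"
      using hilfer False Gamma_real_pos[OF \<beta>_pos]
      by (simp add: psi_frac_int_def H_def[symmetric] zero_less_divide_iff)
    \<comment> \<open>The constant relating the \<beta>-integral of \<open>g\<close> to
      \<open>R\<close>. For \<open>a = 0\<close> the inner integral is the identity and both kernels
      coincide; otherwise the semigroup law gives \<open>Beta a \<beta>\<close> and the
      normalisation of \<open>g\<close> gives \<open>Gamma a\<close>.\<close>
    define \<kappa> where "\<kappa> = (if a = 0 then 1 else Beta a \<beta> / Gamma a)"
    have \<kappa>: "\<kappa> > 0"
    proof (cases "a = 0")
      case False
      then have "a > 0" using a(1) by simp
      then have "Gamma a > 0" "Gamma \<beta> > 0" "Gamma (a + \<beta>) > 0"
        using \<beta>_pos by (simp_all add: Gamma_real_pos)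
      then show ?thesis by (simp add: \<kappa>_def Beta_def)
    qed (simp add: \<kappa>_def)
    have R_g: "((\<lambda>s. (x - s) powr (\<beta> - 1) * g (\<Phi> s)) has_integral \<kappa> * R x) {0..x}"
      if x: "x \<in> {0<..x\<^sub>1}" for x
    proof (cases "a = 0")
      case True
      have "((\<lambda>s. (x - s) powr (\<beta> - 1) * f s) has_integral R x) {0..x}"
        using R[OF x] True ab by (simp add: diff_eq_eq)
      then have "((\<lambda>s. (x - s) powr (\<beta> - 1) * g (\<Phi> s)) has_integral R x) {0..x}"
        \<comment> \<open>\<open>g\<close> is identified in the new time only on
          \<open>(0, x\<^sub>1]\<close>, so the point 0 is discarded.\<close>
        by (rule has_integral_spike[of "{0}", rotated 2]) (use g_\<Phi> x True in auto)
      then show ?thesis using True by (simp add: \<kappa>_def)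
    next
      case False
      with a have a_pos: "a > 0" by simp
      have "((\<lambda>s. (x - s) powr (\<beta> - 1) * S s) has_integral Beta a \<beta> * R x) {0..x}"
      proof (rule has_integral_frac_semigroup[OF \<beta>_pos a_pos _ f_borel f_nonneg])
        show "((\<lambda>u. (s - u) powr (a - 1) * f u) has_integral S s) {0..s}" if "s \<in> {0<..<x}" for s
          using kernel_int[OF a_pos, of s] that x unfolding S_def by (simp add: has_integral_integral)
        have "\<beta> + a - 1 = - \<mu>" using ab by simp
        then show "((\<lambda>u. (x - u) powr (\<beta> + a - 1) * f u) has_integral R x) {0..x}"
          using R[OF x] by simp
      qed (use x in auto)
      then have "((\<lambda>s. (x - s) powr (\<beta> - 1) * S s / Gamma a) has_integral Beta a \<beta> * R x / Gamma a) {0..x}"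
        by (rule has_integral_divide)
      then have "((\<lambda>s. (x - s) powr (\<beta> - 1) * g (\<Phi> s)) has_integral Beta a \<beta> * R x / Gamma a) {0..x}"
        by (rule has_integral_spike[of "{0}", rotated 2]) (use g_\<Phi> x False in auto)
      then show ?thesis using False by (simp add: \<kappa>_def)
    qed
    have "\<exists>L>0. \<forall>\<^sub>F x in at_left x\<^sub>1. \<kappa> * R x \<le> \<kappa> * R x\<^sub>1 - L * (x\<^sub>1 - x)"
    proof (rule frac_integral_left_growth[OF \<beta>_pos \<beta>(2) x1(1)])
      show "0 \<le> g (\<Phi> x)" if "x \<in> {0<..<x\<^sub>1}" for x
        using g_\<Phi>[of x] that f_nonneg[of x] S_nonneg[of x] a(1) Gamma_real_pos[of a] by auto
      show "((\<lambda>x. g (\<Phi> x)) has_real_derivative D x) (at x)" if "x \<in> {0<..<x\<^sub>1}" for x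
        unfolding D_def using that x1 t1 \<Phi>_mem[of t\<^sub>1 x]
        by (intro psi_deriv_pullback diff) (auto simp: x\<^sub>1_def)
    qed (use E_int E_pos R_g in \<open>auto simp: E_def[abs_def]\<close>)
    then obtain L where L: "L > 0" "\<forall>\<^sub>F x in at_left x\<^sub>1. \<kappa> * R x \<le> \<kappa> * R x\<^sub>1 - L * (x\<^sub>1 - x)"
      by blast
    from L(2) have "\<forall>\<^sub>F x in at_left x\<^sub>1. R x \<le> R x\<^sub>1 - (L / \<kappa>) * (x\<^sub>1 - x)"
      by eventually_elim (use \<kappa> in \<open>simp add: field_simps\<close>)
    then show ?thesis using L(1) \<kappa> by (intro exI[of _ "L / \<kappa>"]) auto
  qed
  then obtain L where "L > 0" "\<forall>\<^sub>F x in at_left x\<^sub>1. R x \<le> R x\<^sub>1 - L * (x\<^sub>1 - x)"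
    by blast
  then show False
    using R by (intro frac_integral_no_left_growth[OF \<mu> x1(1) f_borel f_nonneg f_lim]) auto
qed

end
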